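(* Let $G$ be a finite tree in which there exists a vertex whose distances to all leaves of $G$ are equal, and suppose that every vertex of $G$ that is not a leaf has even degree. Then $G$ is friendly to the simple path; that is, the edges of $G$ can be numbered bijectively by $1,2,\ldots,|E(G)|$ so that for every $k$ with $1\le k<|E(G)|$ and every $s\in\mathbb Z$, the path in $G$ between the edges numbered $k$ and $k+1$ contains either both of the edges numbered $k+2s$ and $k+2s+1$, or neither of them.
   Context: All trees are finite. A leaf (hanging vertex) is a vertex of degree $1$; the only vertex of a one-vertex tree is also counted as a leaf. The path between two distinct edges of a tree is the path that joins some endpoint of the first edge to some endpoint of the second edge and contains neither of the two edges; it exists and is unique (it may have zero edges). If a number is outside $\{1,\ldots,|E(G)|\}$, there is no edge with that number, so it counts as not contained in the path. A tree is called friendly to the simple path if its edges admit a numbering with the property displayed in the claim. *)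

theory Defs
  imports Main
begin

text \<open>
  A finite simple graph is given by its vertex set \<open>V\<close> and its set \<open>E\<close> of edges, where an edge
  is the unordered pair \<open>{u, v}\<close> of its two distinct endpoints.
\<close>

definition fin_graph :: "'a set \<Rightarrow> 'a set set \<Rightarrow> bool" where
  "fin_graph V E \<longleftrightarrow> finite V \<and> (\<forall>e\<in>E. \<exists>u\<in>V. \<exists>v\<in>V. u \<noteq> v \<and> e = {u, v})"

definition walk :: "'a set \<Rightarrow> 'a set set \<Rightarrow> 'a list \<Rightarrow> bool" where
  "walk V E p \<longleftrightarrow> p \<noteq> [] \<and> set p \<subseteq> V \<and> successively (\<lambda>u v. {u, v} \<in> E) p"

text \<open>A walk is the list of its vertices, so \<open>[u]\<close> is the walk with zero edges at \<open>u\<close>.\<close>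

definition walk_edges :: "'a list \<Rightarrow> 'a set set" where
  "walk_edges p = set (map2 (\<lambda>u v. {u, v}) p (tl p))"

definition walk_between :: "'a set \<Rightarrow> 'a set set \<Rightarrow> 'a \<Rightarrow> 'a list \<Rightarrow> 'a \<Rightarrow> bool" where
  "walk_between V E u p v \<longleftrightarrow> walk V E p \<and> hd p = u \<and> last p = v"

definition path_between :: "'a set \<Rightarrow> 'a set set \<Rightarrow> 'a \<Rightarrow> 'a list \<Rightarrow> 'a \<Rightarrow> bool" where
  "path_between V E u p v \<longleftrightarrow> walk_between V E u p v \<and> distinct p"

text \<open>
  The base point of a cycle is listed twice, first and last; length at least 4 thus means at
  least three edges and excludes running back and forth along one edge.
\<close>

definition graph_cycle :: "'a set \<Rightarrow> 'a set set \<Rightarrow> 'a list \<Rightarrow> bool" where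
  "graph_cycle V E p \<longleftrightarrow> walk V E p \<and> length p \<ge> 4 \<and> hd p = last p \<and> distinct (tl p)"

definition graph_connected :: "'a set \<Rightarrow> 'a set set \<Rightarrow> bool" where
  "graph_connected V E \<longleftrightarrow> V \<noteq> {} \<and> (\<forall>u\<in>V. \<forall>v\<in>V. \<exists>p. walk_between V E u p v)"

definition fin_tree :: "'a set \<Rightarrow> 'a set set \<Rightarrow> bool" where
  "fin_tree V E \<longleftrightarrow> fin_graph V E \<and> graph_connected V E \<and> (\<nexists>p. graph_cycle V E p)"

definition vertex_degree :: "'a set set \<Rightarrow> 'a \<Rightarrow> nat" where
  "vertex_degree E v = card {e \<in> E. v \<in> e}"

definition leaf :: "'a set \<Rightarrow> 'a set set \<Rightarrow> 'a \<Rightarrow> bool" where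
  "leaf V E v \<longleftrightarrow> v \<in> V \<and> (vertex_degree E v = 1 \<or> V = {v})"

definition graph_dist :: "'a set \<Rightarrow> 'a set set \<Rightarrow> 'a \<Rightarrow> 'a \<Rightarrow> nat" where
  "graph_dist V E u v = (LEAST n. \<exists>p. walk_between V E u p v \<and> length p = Suc n)"

definition joins_edges :: "'a set \<Rightarrow> 'a set set \<Rightarrow> 'a set \<Rightarrow> 'a list \<Rightarrow> 'a set \<Rightarrow> bool" where
  "joins_edges V E e p f \<longleftrightarrow>
     (\<exists>u\<in>e. \<exists>v\<in>f. path_between V E u p v) \<and> e \<notin> walk_edges p \<and> f \<notin> walk_edges p"

text \<open>In a tree, exactly one path joins two given distinct edges in this sense.\<close>

definition path_of_edges :: "'a set \<Rightarrow> 'a set set \<Rightarrow> 'a set \<Rightarrow> 'a set \<Rightarrow> 'a list" where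
  "path_of_edges V E e f = (THE p. joins_edges V E e p f)"

text \<open>
  \<open>num i\<close> is the edge with number \<open>i\<close>. The argument \<open>j\<close> is an integer since it may leave the
  range of the numbering, in which case no edge has number \<open>j\<close>.
\<close>

definition contains_number :: "'a set set \<Rightarrow> (nat \<Rightarrow> 'a set) \<Rightarrow> 'a list \<Rightarrow> int \<Rightarrow> bool" where
  "contains_number E num p j \<longleftrightarrow> 1 \<le> j \<and> j \<le> int (card E) \<and> num (nat j) \<in> walk_edges p"

definition friendly_to_simple_path :: "'a set \<Rightarrow> 'a set set \<Rightarrow> bool" where
  "friendly_to_simple_path V E \<longleftrightarrow>
     (\<exists>num. bij_betw num {1..card E} E \<and>
        (\<forall>k s. 1 \<le> k \<and> k < card E \<longrightarrow>
           (let p = path_of_edges V E (num k) (num (k + 1)) in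
              contains_number E num p (int k + 2 * s) \<longleftrightarrow>
              contains_number E num p (int k + 2 * s + 1))))"

end

theory Submission
  imports Defs
begin

text \<open>
  Root the tree at the vertex equidistant from the leaves and number each edge like its lower
  endpoint, level by level, each level listing the children of the previous one in reverse
  order. Two consecutive edges of one level either have a common parent vertex or have the edges
  above them consecutive as well, so the path between them runs up and down through pairs of
  consecutive edges. The number of children of every inner vertex below the root is odd and every
  level has even size, so the parities of these pairs all match that of \<open>k\<close>. At a
  change of level the two edges are adjacent: a last vertex is followed by its own first child.
\<close>

section \<open>Walks and paths\<close>

lemma walk_append:
  "walk V E (p @ q) \<longleftrightarrow>
     (if p = [] then walk V E q else if q = [] then walk V E p
      else walk V E p \<and> walk V E q \<and> {last p, hd q} \<in> E)"
  by (auto simp: walk_def successively_append_iff)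

lemma walk_append_Cons: "walk V E (p @ x # q) \<longleftrightarrow> walk V E (p @ [x]) \<and> walk V E (x # q)"
  by (auto simp: walk_def successively_append_iff successively_Cons)

lemma walk_rev: "walk V E (rev p) = walk V E p"
  by (simp add: walk_def insert_commute)

lemma walk_between_rev: "walk_between V E u p v \<Longrightarrow> walk_between V E v (rev p) u"
  by (auto simp: walk_between_def walk_rev hd_rev last_rev)

lemma path_between_rev: "path_between V E u p v \<Longrightarrow> path_between V E v (rev p) u"
  by (simp add: path_between_def walk_between_rev)

lemma path_between_Cons:
  assumes "path_between V E u p v" "x \<in> V" "{x, u} \<in> E" "x \<notin> set p"
  shows "path_between V E x (x # p) v"
  using assms by (cases p) (auto simp: path_between_def walk_between_def walk_def)

lemma path_between_snoc:
  assumes "path_between V E u p v" "x \<in> V" "{x, v} \<in> E" "x \<notin> set p"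
  shows "path_between V E u (p @ [x]) x"
  using path_between_rev[OF path_between_Cons[OF path_between_rev[OF assms(1)], of x]] assms
  by simp

lemma path_between_suffix:
  assumes "path_between V E u (p @ x # q) v"
  shows "path_between V E x (x # q) v"
  using assms by (auto simp: path_between_def walk_between_def walk_append split: if_splits)

lemma path_between_prefix:
  assumes "path_between V E u (p @ x # q) v"
  shows "path_between V E u (p @ [x]) x"
  using path_between_rev[OF path_between_suffix[of V E v "rev q" x "rev p" u]]
    path_between_rev[OF assms] by simp

text \<open>Between two occurrences of a vertex the walk can be cut out. The length bound is kept
  for comparing root paths with arbitrary walks in \<open>graph_dist_root\<close>.\<close>

lemma walk_between_imp_path_between:
  assumes "walk_between V E u p v"
  shows "\<exists>q. path_between V E u q v \<and> length q \<le> length p"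
  using assms
proof (induction "length p" arbitrary: p rule: less_induct)
  case less
  show ?case
  proof (cases "distinct p")
    case True
    then show ?thesis using less.prems by (auto simp: path_between_def)
  next
    case False
    then obtain xs ys zs y where p: "p = xs @ [y] @ ys @ [y] @ zs"
      using not_distinct_decomp by blast
    have "walk_between V E u (xs @ [y] @ zs) v"
      using less.prems unfolding p walk_between_def
      using walk_append_Cons[of V E xs y "ys @ y # zs"] walk_append_Cons[of V E xs y zs]
        walk_append_Cons[of V E "y # ys" y zs]
      by (auto simp: hd_append split: if_splits)
    from less.hyps[OF _ this] show ?thesis by (force simp: p)
  qed
qed

text \<open>Follow the first path to its first vertex \<open>z\<close> on the second one, then
  return to \<open>u\<close> along the second. The choice of \<open>z\<close> keeps the two arcs
  disjoint apart from their ends.\<close>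

lemma diverging_paths_give_cycle:
  assumes p: "path_between V E u (u # p) v" and q: "path_between V E u (u # q) v"
    and ne: "p \<noteq> []" "q \<noteq> []" and hd: "hd p \<noteq> hd q"
  shows "\<exists>r. graph_cycle V E r"
proof -
  have "last p = v" "last q = v"
    using p q ne by (auto simp: path_between_def walk_between_def)
  then have "\<exists>x\<in>set p. x \<in> set q" using ne last_in_set by metis
  then obtain p1 z p2 where p_eq: "p = p1 @ z # p2" and z: "z \<in> set q"
    and p1: "\<forall>x\<in>set p1. x \<notin> set q"
    using split_list_first_prop[of p "\<lambda>x. x \<in> set q"] by blast
  from z obtain q1 q2 where q_eq: "q = q1 @ z # q2" by (auto dest: split_list)
  have P: "path_between V E u (u # p1 @ [z]) z"
    using path_between_prefix[of V E u "u # p1" z p2 v] p by (simp add: p_eq)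
  have Q: "path_between V E z (z # rev q1 @ [u]) u"
    using path_between_rev[OF path_between_prefix[of V E u "u # q1" z q2 v]] q
    by (simp add: q_eq)
  have "walk V E ((u # p1 @ [z]) @ (rev q1 @ [u]))"
    using P Q walk_append[of V E "[z]" "rev q1 @ [u]"]
      walk_append[of V E "u # p1 @ [z]" "rev q1 @ [u]"]
    by (simp add: path_between_def walk_between_def)
  \<comment> \<open>The arcs are not both single edges, since \<open>z\<close> would then be the
    head of \<open>p\<close> and of \<open>q\<close>. So the closed walk has at least three
    edges.\<close>
  moreover have "length (p1 @ q1) \<ge> 1"
    using hd by (cases p1; cases q1) (auto simp: p_eq q_eq)
  moreover have "distinct (p1 @ z # rev q1 @ [u])"
    using P Q p1 by (auto simp: path_between_def q_eq)
  ultimately have "graph_cycle V E (u # p1 @ z # rev q1 @ [u])"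
    by (auto simp: graph_cycle_def)
  then show ?thesis ..
qed

text \<open>The first steps agree, as diverging would close a cycle; the induction strips them
  off.\<close>

lemma path_between_unique:
  assumes "\<nexists>r. graph_cycle V E r"
    and "path_between V E u p v" and "path_between V E u q v"
  shows "p = q"
  using assms(2,3)
proof (induction p arbitrary: u q)
  case Nil
  then show ?case by (simp add: path_between_def walk_between_def walk_def)
next
  case (Cons a p)
  from Cons.prems have a: "a = u" by (simp add: path_between_def walk_between_def)
  from Cons.prems obtain q' where q: "q = u # q'"
    by (cases q) (auto simp: path_between_def walk_between_def walk_def)
  show ?case
  proof (cases "p = [] \<or> q' = []")
    \<comment> \<open>If one path stops at once, then \<open>v = u\<close>, and a longer path would
      repeat its start at its end.\<close>
    case True
    then have "v = u" using Cons.prems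
      by (auto simp: a q path_between_def walk_between_def)
    then show ?thesis using Cons.prems last_in_set[of p] last_in_set[of q']
      by (auto simp: a q path_between_def walk_between_def split: if_splits)
  next
    case False
    then have "hd p = hd q'"
      using diverging_paths_give_cycle[of V E u p v q'] assms(1) Cons.prems by (auto simp: a q)
    moreover have "path_between V E (hd p) p v" "path_between V E (hd q') q' v"
      using False path_between_suffix[of V E u "[u]" "hd p" "tl p" v]
        path_between_suffix[of V E u "[u]" "hd q'" "tl q'" v] Cons.prems
      by (auto simp: a q)
    ultimately have "p = q'" using Cons.IH by simp
    then show ?thesis by (simp add: a q)
  qed
qed

section \<open>Edges of a walk and the path joining two edges\<close>

lemma walk_edges_single: "walk_edges [x] = {}"
  by (simp add: walk_edges_def)

lemma walk_edges_Cons: "p \<noteq> [] \<Longrightarrow> walk_edges (x # p) = insert {x, hd p} (walk_edges p)"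
  by (cases p) (auto simp: walk_edges_def)

lemma walk_edges_snoc: "p \<noteq> [] \<Longrightarrow> walk_edges (p @ [x]) = insert {last p, x} (walk_edges p)"
proof (induction p)
  case (Cons a p)
  then show ?case by (cases "p = []") (auto simp: walk_edges_Cons walk_edges_single)
qed simp

lemma walk_edges_rev: "walk_edges (rev p) = walk_edges p"
proof (induction p)
  case (Cons a p)
  then show ?case
    by (cases "p = []") (auto simp: walk_edges_Cons walk_edges_snoc last_rev insert_commute)
qed simp

lemma walk_edges_subset: "e \<in> walk_edges p \<Longrightarrow> e \<subseteq> set p"
  by (cases p) (auto simp: walk_edges_def dest: set_zip_leftD set_zip_rightD)

text \<open>Evaluates the definite description once the endpoints are sorted: \<open>u\<close> and
  \<open>v\<close> face the other edge, \<open>u'\<close> and \<open>v'\<close> are the far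
  ends.\<close>

lemma path_of_edges_eq:
  assumes acyclic: "\<nexists>r. graph_cycle V E r"
    and p: "path_between V E u p v"
    and u': "u' \<in> V" "{u', u} \<in> E" "u' \<notin> set p"
    and v': "v' \<in> V" "{v', v} \<in> E" "v' \<notin> set p" and ne: "u' \<noteq> v'"
  shows "path_of_edges V E {u', u} {v', v} = p"
  unfolding path_of_edges_def
proof (rule the_equality)
  have p_ne: "p \<noteq> []" "hd p = u" "last p = v"
    using p by (auto simp: path_between_def walk_between_def walk_def)
  show "joins_edges V E {u', u} p {v', v}"
    using p u' v' walk_edges_subset[of _ p] by (auto simp: joins_edges_def)
  fix q assume "joins_edges V E {u', u} q {v', v}"
  then obtain x y where q: "path_between V E x q y" and x: "x = u' \<or> x = u"
    and y: "y = v' \<or> y = v" and e: "{u', u} \<notin> walk_edges q" "{v', v} \<notin> walk_edges q"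
    by (auto simp: joins_edges_def)
  \<comment> \<open>By uniqueness these are the only paths for the other choices of endpoints; each
    runs through one of the two edges, which \<open>joins_edges\<close> forbids.\<close>
  have 1: "path_between V E u' (u' # p) v" by (rule path_between_Cons[OF p u'])
  have 2: "path_between V E u (p @ [v']) v'" by (rule path_between_snoc[OF p v'])
  have 3: "path_between V E u' (u' # p @ [v']) v'"
    using path_between_snoc[OF 1 v'(1,2)] v'(3) ne by simp
  note uniq = path_between_unique[OF acyclic q]
  have "{u', u} \<in> walk_edges (u' # p)" "{v', v} \<in> walk_edges (p @ [v'])"
    "{u', u} \<in> walk_edges (u' # p @ [v'])"
    using p_ne by (auto simp: walk_edges_Cons walk_edges_snoc insert_commute)
  then show "q = p" using x y e uniq 1 2 3 p by metis
qed

section \<open>Rooted trees\<close>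

locale rooted_tree =
  fixes V :: "'a set" and E :: "'a set set" and c :: 'a
  assumes tree: "fin_tree V E" and root: "c \<in> V"
begin

text \<open>Listed from \<open>v\<close> towards the root, so that passing to the parent drops the
  head.\<close>

definition root_path :: "'a \<Rightarrow> 'a list" where
  "root_path v = (THE p. path_between V E v p c)"

text \<open>Meaningful only for \<open>v \<noteq> c\<close>: the root path of \<open>c\<close> has
  no second vertex. Hence \<open>c\<close> is excluded in \<open>children\<close>.\<close>

definition parent :: "'a \<Rightarrow> 'a" where
  "parent v = hd (tl (root_path v))"

definition depth :: "'a \<Rightarrow> nat" where
  "depth v = length (root_path v) - 1"

definition children :: "'a \<Rightarrow> 'a set" where
  "children v = {w \<in> V - {c}. parent w = v}"

definition parent_edge :: "'a \<Rightarrow> 'a set" where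
  "parent_edge v = {v, parent v}"

lemma acyclic: "\<nexists>r. graph_cycle V E r"
  using tree by (simp add: fin_tree_def)

lemma finite_V: "finite V"
  using tree by (simp add: fin_tree_def fin_graph_def)

lemma root_path_eq: "path_between V E v p c \<Longrightarrow> root_path v = p"
  unfolding root_path_def using path_between_unique[OF acyclic] by blast

lemma path_between_root_path:
  assumes "v \<in> V"
  shows "path_between V E v (root_path v) c"
proof -
  obtain p where p: "walk_between V E v p c"
    using tree assms root unfolding fin_tree_def graph_connected_def by blast
  obtain q where "path_between V E v q c"
    using walk_between_imp_path_between[OF p] by blast
  then show ?thesis using root_path_eq by simp
qed

lemma root_path_root: "root_path c = [c]"
  using root by (intro root_path_eq) (simp add: path_between_def walk_between_def walk_def)

lemma parent:
  assumes "v \<in> V" "v \<noteq> c"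
  shows parent_in_V: "parent v \<in> V" and parent_edge_in_E: "{v, parent v} \<in> E"
    and root_path_Cons: "root_path v = v # root_path (parent v)"
proof -
  note p = path_between_root_path[OF assms(1)]
  have ne: "root_path v \<noteq> []" and hd: "hd (root_path v) = v" and last: "last (root_path v) = c"
    using p by (auto simp: path_between_def walk_between_def walk_def)
  then obtain r where r: "root_path v = v # r" by (cases "root_path v") auto
  with last assms(2) obtain y q where q: "root_path v = v # y # q" by (cases r) auto
  have "path_between V E y (y # q) c"
    using path_between_suffix[of V E v "[v]" y q c] p q by simp
  then have "root_path y = y # q" by (rule root_path_eq)
  then show "root_path v = v # root_path (parent v)" by (simp add: parent_def q)
  show "parent v \<in> V" "{v, parent v} \<in> E"
    using p by (auto simp: parent_def q path_between_def walk_between_def walk_def)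
qed

lemma depth_root: "depth c = 0"
  by (simp add: depth_def root_path_root)

lemma depth_parent:
  assumes "v \<in> V" "v \<noteq> c"
  shows "depth v = Suc (depth (parent v))"
proof -
  have "root_path (parent v) \<noteq> []"
    using path_between_root_path[OF parent_in_V[OF assms]]
    by (auto simp: path_between_def walk_between_def walk_def)
  then show ?thesis by (simp add: depth_def root_path_Cons[OF assms])
qed

lemma depth_eq_0_iff: "v \<in> V \<Longrightarrow> depth v = 0 \<longleftrightarrow> v = c"
  using depth_parent depth_root by fastforce

section \<open>Edges, degrees and distances seen from the root\<close>

text \<open>If \<open>x\<close> is off the root path of \<open>y\<close>, putting \<open>x\<close>
  in front gives the root path of \<open>x\<close>. Otherwise the part from \<open>y\<close> to
  \<open>x\<close> must, by uniqueness, be the edge itself.\<close>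

lemma edge_cases:
  assumes "{x, y} \<in> E"
  shows "(x \<noteq> c \<and> y = parent x) \<or> (y \<noteq> c \<and> x = parent y)"
proof -
  have V: "x \<in> V" "y \<in> V" "x \<noteq> y"
    using tree assms by (auto simp: fin_tree_def fin_graph_def doubleton_eq_iff)
  note px = path_between_root_path[OF V(1)] and py = path_between_root_path[OF V(2)]
  have hd: "a = y" if "root_path y = a # q" for a q
    using py that by (simp add: path_between_def walk_between_def)
  show ?thesis
  proof (cases "x \<in> set (root_path y)")
    case False
    then have "root_path x = x # root_path y"
      using root_path_eq[OF path_between_Cons[OF py V(1) assms]] by simp
    moreover have "x \<noteq> c" using False py last_in_set[of "root_path y"]
      by (auto simp: path_between_def walk_between_def walk_def)
    moreover have "root_path y \<noteq> []" "hd (root_path y) = y"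
      using py by (auto simp: path_between_def walk_between_def walk_def)
    ultimately show ?thesis by (simp add: parent_def)
  next
    case True
    then obtain p q where pq: "root_path y = p @ x # q" by (auto dest: split_list)
    have 1: "path_between V E y (p @ [x]) x"
      using path_between_prefix[of V E y p x q c] py pq by simp
    have 2: "path_between V E y [y, x] x" using V assms
      by (auto simp: path_between_def walk_between_def walk_def insert_commute)
    have "p = [y]" using path_between_unique[OF acyclic 1 2] by simp
    then have eq: "root_path y = y # x # q" using pq by simp
    then have "y \<noteq> c" using root_path_root by auto
    then show ?thesis using eq by (simp add: parent_def)
  qed
qed

text \<open>Two vertices sharing a parent edge would be parents of each other, contradicting the
  depths.\<close>

lemma inj_on_parent_edge: "inj_on parent_edge (V - {c})"
proof (rule inj_onI)
  fix v w assume v: "v \<in> V - {c}" and w: "w \<in> V - {c}" and eq: "parent_edge v = parent_edge w"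
  show "v = w"
  proof (rule ccontr)
    assume "v \<noteq> w"
    then have "v = parent w" "w = parent v"
      using eq by (auto simp: parent_edge_def doubleton_eq_iff)
    then show False using depth_parent[of v] depth_parent[of w] v w by auto
  qed
qed

lemma parent_edge_image: "parent_edge ` (V - {c}) = E"
proof
  show "parent_edge ` (V - {c}) \<subseteq> E"
    using parent_edge_in_E by (auto simp: parent_edge_def)
  show "E \<subseteq> parent_edge ` (V - {c})"
  proof
    fix e assume e: "e \<in> E"
    then obtain x y where xy: "x \<in> V" "y \<in> V" "e = {x, y}"
      using tree by (auto simp: fin_tree_def fin_graph_def)
    then show "e \<in> parent_edge ` (V - {c})"
      using edge_cases[of x y] e by (auto simp: parent_edge_def image_iff insert_commute)
  qed
qed

lemma finite_children: "finite (children v)"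
  using finite_V by (simp add: children_def)

text \<open>The edges at \<open>v\<close> are the parent edges of its children and, below the root,
  its own.\<close>

lemma vertex_degree_eq:
  assumes "v \<in> V"
  shows "vertex_degree E v = card (children v) + (if v = c then 0 else 1)"
proof -
  let ?S = "children v \<union> (if v = c then {} else {v})"
  have "{e \<in> E. v \<in> e} = parent_edge ` {w \<in> V - {c}. v \<in> parent_edge w}"
    by (subst parent_edge_image[symmetric]) blast
  also have "{w \<in> V - {c}. v \<in> parent_edge w} = ?S"
    using assms by (auto simp: parent_edge_def children_def)
  finally have "vertex_degree E v = card (parent_edge ` ?S)"
    by (simp add: vertex_degree_def)
  also have "\<dots> = card ?S"
    using assms by (intro card_image inj_on_subset[OF inj_on_parent_edge])
      (auto simp: children_def)
  also have "\<dots> = card (children v) + (if v = c then 0 else 1)"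
  proof -
    have "v \<notin> children v" using depth_parent[OF assms] by (auto simp: children_def)
    then show ?thesis using finite_children by simp
  qed
  finally show ?thesis .
qed

text \<open>Any walk shortens to a path, and the only path is the root path.\<close>

lemma graph_dist_root:
  assumes "v \<in> V"
  shows "graph_dist V E c v = depth v"
  unfolding graph_dist_def
proof (rule Least_equality)
  note p = path_between_root_path[OF assms]
  then have "walk_between V E c (rev (root_path v)) v" "root_path v \<noteq> []"
    using walk_between_rev[of V E v "root_path v" c]
    by (auto simp: path_between_def walk_between_def walk_def)
  then show "\<exists>p. walk_between V E c p v \<and> length p = Suc (depth v)"
    by (intro exI[of _ "rev (root_path v)"]) (simp add: depth_def)
  fix n assume "\<exists>p. walk_between V E c p v \<and> length p = Suc n"
  then obtain p where p: "walk_between V E c p v" "length p = Suc n" by blast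
  obtain q where "path_between V E v q c" "length q \<le> length (rev p)"
    using walk_between_imp_path_between[OF walk_between_rev[OF p(1)]] by blast
  then show "depth v \<le> n" using root_path_eq p(2) by (fastforce simp: depth_def)
qed

section \<open>Paths between consecutive entries of a boustrophedon list\<close>

text \<open>
  The second disjunct of the last clause says that the parents of the vertices at positions
  \<open>k\<close> and \<open>k + 1\<close> stand at positions \<open>j + 1\<close> and \<open>j\<close>: each level lists the parents of the next
  one backwards.
\<close>

definition boustrophedon :: "'a list \<Rightarrow> bool" where
  "boustrophedon ws \<longleftrightarrow>
     (\<forall>k. Suc k < length ws \<longrightarrow>
        parent (ws ! Suc k) = ws ! k \<or>
        depth (ws ! k) = depth (ws ! Suc k) \<and>
        (parent (ws ! k) = parent (ws ! Suc k) \<or>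
         (\<exists>j. Suc j < length ws \<and> even (j + k) \<and>
              parent (ws ! k) = ws ! Suc j \<and> parent (ws ! Suc k) = ws ! j)))"

text \<open>Induction on the depth. \<open>A\<close> collects the lower positions of the pairs of
  consecutive parent edges on the path; the depth bound ensures that extending the path by deeper
  vertices repeats none.\<close>

lemma boustrophedon_same_depth_path:
  assumes ws: "boustrophedon ws" "set ws \<subseteq> V - {c}"
    and "Suc k < length ws" "depth (ws ! k) = depth (ws ! Suc k)"
  shows "\<exists>p A. path_between V E (parent (ws ! k)) p (parent (ws ! Suc k)) \<and>
    (\<forall>z\<in>set p. depth z < depth (ws ! k)) \<and>
    walk_edges p = (\<Union>a\<in>A. {parent_edge (ws ! a), parent_edge (ws ! Suc a)}) \<and>
    (\<forall>a\<in>A. Suc a < length ws \<and> even (a + k))"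
  using assms(3,4)
proof (induction "depth (ws ! k)" arbitrary: k rule: less_induct)
  case less
  have V: "ws ! i \<in> V" "ws ! i \<noteq> c" if "i < length ws" for i
    using that ws(2) nth_mem by blast+
  have dp: "depth (ws ! i) = Suc (depth (parent (ws ! i)))" if "i < length ws" for i
    using depth_parent V that by blast
  have k: "k < length ws" using less.prems by simp
  from ws(1) less.prems consider (parent) "parent (ws ! Suc k) = ws ! k"
    | (same) "parent (ws ! k) = parent (ws ! Suc k)"
    | (diff) j where "parent (ws ! k) \<noteq> parent (ws ! Suc k)" "Suc j < length ws" "even (j + k)"
      "parent (ws ! k) = ws ! Suc j" "parent (ws ! Suc k) = ws ! j"
    unfolding boustrophedon_def by blast
  then show ?case
  proof cases
    case parent
    \<comment> \<open>A parent is less deep than its child, against the equal depths.\<close>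
    then show ?thesis using dp[OF less.prems(1)] less.prems(2) by simp
  next
    case same
    then show ?thesis
      using dp[OF k] parent_in_V[OF V[OF k]]
      by (intro exI[of _ "[parent (ws ! k)]"] exI[of _ "{}"])
        (simp add: path_between_def walk_between_def walk_def walk_edges_single)
  next
    case (diff j)
    let ?x = "ws ! Suc j" and ?y = "ws ! j"
    have j: "j < length ws" using diff by simp
    have d: "depth (ws ! k) = Suc (depth ?x)" "depth (ws ! k) = Suc (depth ?y)"
      using dp[OF k] dp[OF less.prems(1)] less.prems(2) diff by simp_all
    \<comment> \<open>One level up, the hypothesis leads from \<open>parent ?y\<close> to
      \<open>parent ?x\<close>. As the parents stand in reverse order, this path is reversed before
      \<open>?x\<close> and \<open>?y\<close> are attached; their parent edges contribute the new
      pair \<open>j\<close>.\<close>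
    from less.hyps[of j] d diff obtain p A where
      p: "path_between V E (parent ?y) p (parent ?x)" "\<forall>z\<in>set p. depth z < depth ?y"
      and A: "walk_edges p = (\<Union>a\<in>A. {parent_edge (ws ! a), parent_edge (ws ! Suc a)})"
        "\<forall>a\<in>A. Suc a < length ws \<and> even (a + j)"
      by auto
    have notin: "?x \<notin> set p" "?y \<notin> set p" using p(2) d by auto
    have "path_between V E ?x (?x # rev p) (parent ?y)"
      using path_between_Cons[OF path_between_rev[OF p(1)], of ?x] V[OF diff(2)]
        parent_edge_in_E notin by auto
    then have "path_between V E ?x ((?x # rev p) @ [?y]) ?y"
      using path_between_snoc[of V E ?x "?x # rev p" "parent ?y" ?y] V[OF j]
        parent_edge_in_E notin diff by auto
    moreover have "\<forall>z\<in>set ((?x # rev p) @ [?y]). depth z < depth (ws ! k)"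
      using p(2) d by auto
    moreover have "walk_edges ((?x # rev p) @ [?y]) =
      (\<Union>a\<in>insert j A. {parent_edge (ws ! a), parent_edge (ws ! Suc a)})"
    proof -
      have "p \<noteq> []" "hd p = parent ?y" "last p = parent ?x"
        using p by (auto simp: path_between_def walk_between_def walk_def)
      then show ?thesis
        unfolding UN_insert A(1)[symmetric]
        by (auto simp: walk_edges_Cons walk_edges_snoc walk_edges_rev hd_append hd_rev last_rev
            parent_edge_def insert_commute)
    qed
    moreover have "\<forall>a\<in>insert j A. Suc a < length ws \<and> even (a + k)"
      using A(2) diff by auto
    ultimately show ?thesis unfolding diff(4,5) by blast
  qed
qed

text \<open>At equal depth the path between the parents is the path between the edges; at a change
  of level the edges share a vertex and the path has no edges.\<close>

lemma boustrophedon_path_of_edges: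
  assumes ws: "boustrophedon ws" "set ws \<subseteq> V - {c}" "distinct ws" and k: "Suc k < length ws"
  shows "\<exists>A. walk_edges (path_of_edges V E (parent_edge (ws ! k)) (parent_edge (ws ! Suc k))) =
    (\<Union>a\<in>A. {parent_edge (ws ! a), parent_edge (ws ! Suc a)}) \<and>
    (\<forall>a\<in>A. Suc a < length ws \<and> even (a + k))"
proof -
  let ?x = "ws ! k" and ?y = "ws ! Suc k"
  have V: "?x \<in> V" "?x \<noteq> c" "?y \<in> V" "?y \<noteq> c"
    using subsetD[OF ws(2) nth_mem[OF Suc_lessD[OF k]]] subsetD[OF ws(2) nth_mem[OF k]] by auto
  have "?x \<noteq> ?y" using ws(3) k by (simp add: nth_eq_iff_index_eq)
  note dx = depth_parent[OF V(1,2)] and dy = depth_parent[OF V(3,4)]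
  from ws(1) k consider "parent ?y = ?x" | "depth ?x = depth ?y"
    unfolding boustrophedon_def by blast
  then show ?thesis
  proof cases
    case 1
    \<comment> \<open>The common vertex \<open>?x\<close> is the lower end of the first edge and the
      upper end of the second, so the far ends are \<open>parent ?x\<close> and
      \<open>?y\<close>.\<close>
    have "path_of_edges V E {parent ?x, ?x} {?y, ?x} = [?x]"
    proof (rule path_of_edges_eq[OF acyclic])
      show "path_between V E ?x [?x] ?x"
        using V(1) by (simp add: path_between_def walk_between_def walk_def)
      show "{parent ?x, ?x} \<in> E" "{?y, ?x} \<in> E"
        using parent_edge_in_E[OF V(1,2)] parent_edge_in_E[OF V(3,4)]
        unfolding 1 by (simp_all only: insert_commute)
      have "depth ?x = Suc (depth (parent ?x))" "depth ?y = Suc (depth ?x)"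
        using dx dy unfolding 1 .
      then have "depth (parent ?x) \<noteq> depth ?x" "depth ?y \<noteq> depth ?x"
        "depth (parent ?x) \<noteq> depth ?y"
        by linarith+
      then show "parent ?x \<notin> set [?x]" "?y \<notin> set [?x]" "parent ?x \<noteq> ?y" by auto
      show "parent ?x \<in> V" "?y \<in> V" using parent_in_V[OF V(1,2)] V(3) .
    qed
    moreover have "parent_edge ?x = {parent ?x, ?x}" "parent_edge ?y = {?y, ?x}"
      unfolding parent_edge_def 1 by (rule insert_commute, rule refl)
    ultimately have "walk_edges (path_of_edges V E (parent_edge ?x) (parent_edge ?y)) = {}"
      by (simp only: walk_edges_single)
    then show ?thesis by (intro exI[of _ "{}"]) simp
  next
    case 2
    from boustrophedon_same_depth_path[OF ws(1,2) k 2] obtain p A where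
      p: "path_between V E (parent ?x) p (parent ?y)" "\<forall>z\<in>set p. depth z < depth ?x"
      and A: "walk_edges p = (\<Union>a\<in>A. {parent_edge (ws ! a), parent_edge (ws ! Suc a)})"
        "\<forall>a\<in>A. Suc a < length ws \<and> even (a + k)"
      by blast
    \<comment> \<open>\<open>?x\<close> and \<open>?y\<close> are deeper than all vertices of
      \<open>p\<close>, hence off it.\<close>
    have "path_of_edges V E (parent_edge ?x) (parent_edge ?y) = p"
      unfolding parent_edge_def
      using V p(2) 2 \<open>?x \<noteq> ?y\<close> parent_edge_in_E[OF V(1,2)] parent_edge_in_E[OF V(3,4)]
      by (intro path_of_edges_eq[OF acyclic p(1)]) auto
    then show ?thesis using A by auto
  qed
qed

lemma boustrophedon_imp_friendly:
  assumes ws: "boustrophedon ws" "set ws = V - {c}" "distinct ws"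
  shows "friendly_to_simple_path V E"
proof -
  \<comment> \<open>Numbers start at 1, list positions at 0.\<close>
  define num where "num i = parent_edge (ws ! (i - 1))" for i
  have len: "card E = length ws"
    using card_image[OF inj_on_parent_edge] distinct_card[OF ws(3)]
    by (simp add: parent_edge_image ws(2))
  have inj: "parent_edge (ws ! i) = parent_edge (ws ! j) \<longleftrightarrow> i = j"
    if "i < length ws" "j < length ws" for i j
    using that ws nth_eq_iff_index_eq[OF ws(3)] inj_on_parent_edge
    by (metis inj_on_eq_iff nth_mem)
  have bij: "bij_betw num {1..card E} E"
    unfolding bij_betw_def
  proof
    show inj_num: "inj_on num {1..card E}"
      by (rule inj_onI) (auto simp: num_def len inj)
    have "num ` {1..card E} \<subseteq> E"
    proof
      fix e assume "e \<in> num ` {1..card E}"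
      then obtain i where "i \<in> {1..length ws}" and e: "e = parent_edge (ws ! (i - 1))"
        unfolding num_def len by blast
      then have "ws ! (i - 1) \<in> set ws" by (intro nth_mem) auto
      then show "e \<in> E" using parent_edge_image ws(2) e by blast
    qed
    moreover have "finite E"
      using finite_imageI[of "V - {c}" parent_edge] finite_V by (simp add: parent_edge_image)
    ultimately show "num ` {1..card E} = E"
      using card_image[OF inj_num] by (simp add: card_subset_eq)
  qed
  have "contains_number E num p (int k + 2 * s) \<longleftrightarrow> contains_number E num p (int k + 2 * s + 1)"
    if k: "1 \<le> k" "k < card E" and p: "p = path_of_edges V E (num k) (num (k + 1))" for k s p
  proof -
    from k obtain k' where k': "k = Suc k'" by (cases k) auto
    have "p = path_of_edges V E (parent_edge (ws ! k')) (parent_edge (ws ! Suc k'))"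
      by (simp add: p num_def k')
    with boustrophedon_path_of_edges[OF ws(1) equalityD1[OF ws(2)] ws(3), of k'] k(2)
    obtain A where
      A: "walk_edges p = (\<Union>a\<in>A. {parent_edge (ws ! a), parent_edge (ws ! Suc a)})"
      and A': "\<And>a. a \<in> A \<Longrightarrow> Suc a < length ws" "\<And>a. a \<in> A \<Longrightarrow> even (a + k')"
      unfolding k' len by blast
    \<comment> \<open>Position \<open>a\<close> carries number \<open>a + 1\<close>. Since
      \<open>Suc a < length ws\<close>, no pair leaves the range of the numbering, so this holds for
      every integer \<open>j\<close>.\<close>
    have contains: "contains_number E num p j \<longleftrightarrow> (\<exists>a\<in>A. j = int a + 1 \<or> j = int a + 2)" for j
    proof
      assume "contains_number E num p j"
      then obtain a where "1 \<le> j" "j \<le> int (length ws)" and a: "a \<in> A"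
        "parent_edge (ws ! (nat j - 1)) = parent_edge (ws ! a) \<or>
         parent_edge (ws ! (nat j - 1)) = parent_edge (ws ! Suc a)"
        by (auto simp: contains_number_def num_def A len)
      then have "nat j - 1 = a \<or> nat j - 1 = Suc a"
        using inj[of "nat j - 1" a] inj[of "nat j - 1" "Suc a"] A'(1)[of a] by linarith
      then show "\<exists>a\<in>A. j = int a + 1 \<or> j = int a + 2"
        using a(1) \<open>1 \<le> j\<close> by (intro bexI[of _ a]) auto
    next
      assume "\<exists>a\<in>A. j = int a + 1 \<or> j = int a + 2"
      then obtain a where a: "a \<in> A" "j = int a + 1 \<or> j = int a + 2" by blast
      then have "nat j - 1 = a \<or> nat j - 1 = Suc a" by auto
      then show "contains_number E num p j"
        using a A'(1)[of a] by (auto simp: contains_number_def num_def A len)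
    qed
    have parity: "even (int a + int k')" if "a \<in> A" for a
      using A'(2)[OF that] by presburger
    show ?thesis unfolding contains
    proof (rule bex_cong[OF refl])
      fix a assume "a \<in> A"
      from parity[OF this]
      \<comment> \<open>Since \<open>k = Suc k'\<close> and \<open>a\<close> has the parity of
        \<open>k'\<close>, the numbers \<open>k + 2 * s\<close> and \<open>a + 1\<close> have equal
        parity. Both sides thus reduce to \<open>k + 2 * s = a + 1\<close>.\<close>
      show "(int k + 2 * s = int a + 1 \<or> int k + 2 * s = int a + 2) \<longleftrightarrow>
        (int k + 2 * s + 1 = int a + 1 \<or> int k + 2 * s + 1 = int a + 2)"
        unfolding k' of_nat_Suc by presburger
    qed
  qed
  then show ?thesis
    unfolding friendly_to_simple_path_def Let_def using bij by blast
qed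

end

section \<open>The boustrophedon order\<close>

lemma distinct_concat_map:
  assumes "distinct xs" "\<And>x. x \<in> set xs \<Longrightarrow> distinct (f x)"
    and "\<And>x y. \<lbrakk>x \<in> set xs; y \<in> set xs; x \<noteq> y\<rbrakk> \<Longrightarrow> set (f x) \<inter> set (f y) = {}"
  shows "distinct (concat (map f xs))"
  using assms
proof (induction xs)
  case (Cons a xs)
  have "set (f a) \<inter> set (f x) = {}" if "x \<in> set xs" for x
    using Cons.prems(1) Cons.prems(3)[of a x] that by auto
  then show ?case using Cons by auto
qed simp

lemma even_length_concat:
  "(\<And>xs. xs \<in> set xss \<Longrightarrow> odd (length xs)) \<Longrightarrow> even (length (concat xss)) \<longleftrightarrow> even (length xss)"
  by (induction xss) auto

text \<open>When a step crosses from block \<open>m\<close> to the next, \<open>i + 1\<close> is the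
  total length of \<open>m + 1\<close> odd blocks, which gives the parity. In the induction,
  removing the first block shifts \<open>i\<close> by an odd number and \<open>m\<close> by
  one.\<close>

lemma concat_odd_blocks_cases:
  assumes "\<And>xs. xs \<in> set xss \<Longrightarrow> odd (length xs)" and "Suc i < length (concat xss)"
  shows "(\<exists>m<length xss. concat xss ! i \<in> set (xss ! m) \<and> concat xss ! Suc i \<in> set (xss ! m)) \<or>
    (\<exists>m. Suc m < length xss \<and> concat xss ! i \<in> set (xss ! m) \<and>
       concat xss ! Suc i \<in> set (xss ! Suc m) \<and> even (i + m))"
  using assms
proof (induction xss arbitrary: i)
  case (Cons xs xss)
  have odd: "odd (length xs)" using Cons.prems by simp
  consider "Suc i < length xs" | "Suc i = length xs" | "length xs \<le> i" by linarith
  then show ?case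
  proof cases
    case 1
    then have "concat (xs # xss) ! i \<in> set ((xs # xss) ! 0)"
      "concat (xs # xss) ! Suc i \<in> set ((xs # xss) ! 0)"
      by (simp_all add: nth_append)
    then show ?thesis by (metis length_greater_0_conv list.distinct(1))
  next
    case 2
    then obtain ys yss where xss: "xss = ys # yss" using Cons.prems(2) by (cases xss) auto
    \<comment> \<open>An odd block is nonempty, so the next entry does lie in the very next
      block.\<close>
    then have "length ys > 0" by (intro odd_pos Cons.prems(1)) (simp add: xss)
    then have "concat (xs # xss) ! i \<in> set ((xs # xss) ! 0)"
      "concat (xs # xss) ! Suc i \<in> set ((xs # xss) ! Suc 0)"
      using 2 by (auto simp: nth_append xss)
    moreover have "even (i + 0)" using 2 odd by presburger
    ultimately show ?thesis by (intro disjI2 exI[of _ 0]) (simp add: xss)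
  next
    case 3
    define i' where "i' = i - length xs"
    have i: "i = length xs + i'" using 3 by (simp add: i'_def)
    have nth: "concat (xs # xss) ! i = concat xss ! i'"
      "concat (xs # xss) ! Suc i = concat xss ! Suc i'"
      by (simp_all add: i nth_append)
    have "odd (length ys)" if "ys \<in> set xss" for ys
      using Cons.prems(1) that by simp
    moreover have "Suc i' < length (concat xss)" using Cons.prems(2) by (simp add: i)
    ultimately have "(\<exists>m<length xss. concat xss ! i' \<in> set (xss ! m) \<and>
        concat xss ! Suc i' \<in> set (xss ! m)) \<or>
      (\<exists>m. Suc m < length xss \<and> concat xss ! i' \<in> set (xss ! m) \<and>
        concat xss ! Suc i' \<in> set (xss ! Suc m) \<and> even (i' + m))"
      by (rule Cons.IH)
    then show ?thesis
    proof (elim disjE exE conjE)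
      fix m assume "m < length xss" "concat xss ! i' \<in> set (xss ! m)"
        "concat xss ! Suc i' \<in> set (xss ! m)"
      then show ?thesis unfolding nth by (intro disjI1 exI[of _ "Suc m"]) simp
    next
      fix m assume "Suc m < length xss" "concat xss ! i' \<in> set (xss ! m)"
        "concat xss ! Suc i' \<in> set (xss ! Suc m)" "even (i' + m)"
      then show ?thesis using odd unfolding nth by (intro disjI2 exI[of _ "Suc m"]) (simp add: i)
    qed
  qed
qed simp

section \<open>Parity of the numbers of children\<close>

text \<open>Excluding the one-vertex tree makes \<open>d\<close> positive; the root is then not a
  leaf and has even degree.\<close>

locale equidistant_leaves_tree = rooted_tree +
  fixes d :: nat
  assumes leaves: "leaf V E l \<Longrightarrow> graph_dist V E c l = d"
    and even_degree: "\<lbrakk>v \<in> V; \<not> leaf V E v\<rbrakk> \<Longrightarrow> even (vertex_degree E v)"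
    and nontrivial: "V \<noteq> {c}"
begin

lemma childless_depth:
  assumes "v \<in> V" "v \<noteq> c" "children v = {}"
  shows "depth v = d"
  using assms leaves[of v] graph_dist_root[of v] vertex_degree_eq[of v] by (simp add: leaf_def)

text \<open>A vertex of maximal depth is childless and hence has depth \<open>d\<close>.\<close>

lemma depth_le_and_pos: "(\<forall>v\<in>V. depth v \<le> d) \<and> d > 0"
proof -
  obtain w where w: "w \<in> V" "w \<noteq> c" using nontrivial root by blast
  obtain z where z: "z \<in> V" "\<And>v. v \<in> V \<Longrightarrow> depth v \<le> depth z"
    using finite_V root Max_in[of "depth ` V"] Max_ge[of "depth ` V"] by fastforce
  have "depth w > 0" using depth_eq_0_iff[OF w(1)] w(2) by simp
  then have pos: "depth z > 0" using z(2)[OF w(1)] by simp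
  then have "z \<noteq> c" using depth_root by auto
  moreover have "children z = {}"
    using z(2) depth_parent by (fastforce simp: children_def)
  ultimately have "depth z = d" using childless_depth z(1) by blast
  then show ?thesis using z(2) pos by simp
qed

lemma even_card_children_root: "even (card (children c))"
proof -
  have "\<not> leaf V E c"
    using leaves[of c] graph_dist_root[OF root] depth_root depth_le_and_pos by auto
  then show ?thesis using even_degree[OF root] vertex_degree_eq[OF root] by simp
qed

text \<open>Such a vertex has children, so it is no leaf; one of its evenly many edges leads
  up.\<close>

lemma odd_card_children:
  assumes "v \<in> V" "v \<noteq> c" "depth v < d"
  shows "odd (card (children v))"
proof -
  have "children v \<noteq> {}" using childless_depth assms by blast
  then have "card (children v) \<noteq> 0" using finite_children by simp
  then have "\<not> leaf V E v"
    using vertex_degree_eq[OF assms(1)] assms(2) root by (auto simp: leaf_def)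
  then show ?thesis
    using even_degree[OF assms(1)] assms(2) vertex_degree_eq[OF assms(1)] by simp
qed

section \<open>The levels and their concatenation\<close>

text \<open>Any order of siblings will do, as \<open>boustrophedon\<close> accepts neighbours with a
  common parent.\<close>

definition child_list :: "'a \<Rightarrow> 'a list" where
  "child_list v = (SOME xs. set xs = children v \<and> distinct xs)"

lemma child_list: "set (child_list v) = children v" "distinct (child_list v)"
  using someI_ex[OF finite_distinct_list[OF finite_children[of v]]]
  by (simp_all add: child_list_def)

lemma length_child_list: "length (child_list v) = card (children v)"
  using distinct_card child_list by metis

text \<open>Because of \<open>rev\<close>, the children of the last vertex of a level open the next
  level.\<close>

primrec level :: "nat \<Rightarrow> 'a list" where
  "level 0 = [c]"
| "level (Suc t) = concat (map child_list (rev (level t)))"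

text \<open>Starts at level 1 because the root has no parent edge.\<close>

definition level_order :: "nat \<Rightarrow> 'a list" where
  "level_order t = concat (map level [1..<Suc t])"

lemma level_order_0: "level_order 0 = []"
  by (simp add: level_order_def)

lemma level_order_Suc: "level_order (Suc t) = level_order t @ level (Suc t)"
  by (simp add: level_order_def)

lemma set_level: "set (level t) = {v \<in> V. depth v = t}"
proof (induction t)
  case 0
  then show ?case using depth_eq_0_iff root by auto
next
  case (Suc t)
  have "set (level (Suc t)) = {w \<in> V - {c}. parent w \<in> set (level t)}"
    by (auto simp: child_list children_def)
  also have "\<dots> = {v \<in> V. depth v = Suc t}"
    unfolding Suc using depth_parent parent_in_V depth_root by fastforce
  finally show ?case .
qed

lemma distinct_level: "distinct (level t)"
proof (induction t)
  case (Suc t)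
  show ?case unfolding level.simps
    by (rule distinct_concat_map) (use Suc in \<open>auto simp: child_list children_def\<close>)
qed simp

lemma odd_length_child_list:
  assumes "v \<in> set (level t)" "0 < t" "t < d"
  shows "odd (length (child_list v))"
proof -
  have "v \<in> V" "depth v = t" using assms(1) by (auto simp: set_level)
  moreover from this have "v \<noteq> c" using assms(2) depth_root by auto
  ultimately show ?thesis using odd_card_children assms(3) by (simp add: length_child_list)
qed

text \<open>Level 1 consists of the evenly many children of the root. Each later level has one odd
  block per vertex of the level above and so inherits its parity.\<close>

lemma even_length_level:
  assumes "Suc t \<le> d"
  shows "even (length (level (Suc t)))"
  using assms
proof (induction t)
  case 0
  then show ?case using even_card_children_root by (simp add: length_child_list)
next
  case (Suc t)
  let ?B = "map child_list (rev (level (Suc t)))"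
  have "odd (length xs)" if "xs \<in> set ?B" for xs
    using that odd_length_child_list[of _ "Suc t"] Suc.prems by (auto simp del: level.simps)
  then have "even (length (concat ?B)) \<longleftrightarrow> even (length ?B)" by (rule even_length_concat)
  then show ?case
    unfolding level.simps(2)[of "Suc t"] using Suc by (simp del: level.simps)
qed

lemma even_length_level_order: "t \<le> d \<Longrightarrow> even (length (level_order t))"
proof (induction t)
  case (Suc t)
  then show ?case using even_length_level[of t] by (simp add: level_order_Suc)
qed (simp add: level_order_0)

lemma set_level_order: "set (level_order t) = {v \<in> V - {c}. depth v \<le> t}"
proof (induction t)
  case 0
  then show ?case using depth_eq_0_iff by (auto simp: level_order_0)
next
  case (Suc t)
  have "v \<noteq> c" if "depth v = Suc t" for v using that depth_root by auto
  then show ?case unfolding level_order_Suc set_append Suc set_level by (auto simp: le_Suc_eq)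
qed

lemma distinct_level_order: "distinct (level_order t)"
proof (induction t)
  case (Suc t)
  have "set (level_order t) \<inter> set (level (Suc t)) = {}"
    unfolding set_level_order set_level by auto
  then show ?case using Suc distinct_level[of "Suc t"]
    unfolding level_order_Suc distinct_append by blast
qed (simp add: level_order_0)

text \<open>A level is appended at a time; the pair \<open>k\<close>, \<open>k + 1\<close> lies in
  the old list, at the seam, or in the new level.\<close>

lemma boustrophedon_level_order: "t \<le> d \<Longrightarrow> boustrophedon (level_order t)"
proof (induction t)
  case 0
  then show ?case by (simp add: boustrophedon_def level_order_0)
next
  case (Suc t)
  let ?W = "level_order t" and ?L = "level (Suc t)"
  let ?ws = "?W @ ?L"
  have L: "parent v \<in> set (level t)" "depth v = Suc t" if "v \<in> set ?L" for v
    using that set_level[of "Suc t"] by (auto simp: child_list children_def)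
  have block: "parent w = v" if "w \<in> set (child_list v)" for v w
    using that by (simp add: child_list children_def)
  show ?case unfolding boustrophedon_def level_order_Suc
  proof (intro allI impI)
    fix k assume k: "Suc k < length ?ws"
    let ?G = "\<lambda>ws. parent (ws ! Suc k) = ws ! k \<or>
        depth (ws ! k) = depth (ws ! Suc k) \<and>
        (parent (ws ! k) = parent (ws ! Suc k) \<or>
         (\<exists>j. Suc j < length ws \<and> even (j + k) \<and>
              parent (ws ! k) = ws ! Suc j \<and> parent (ws ! Suc k) = ws ! j))"
    consider "Suc k < length ?W" | "Suc k = length ?W" | "length ?W \<le> k" by linarith
    then show "?G ?ws"
    proof cases
      case 1
      then have "?G ?W" using Suc unfolding boustrophedon_def by simp
      moreover have "?ws ! i = ?W ! i" if "i < length ?W" for i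
        using that by (simp add: nth_append)
      moreover have "Suc j < length ?ws" if "Suc j < length ?W" for j
        using that by simp
      ultimately show ?thesis using 1 by (metis Suc_lessD)
    next
      case 2
      \<comment> \<open>There is no seam before level 1, the list being empty there.\<close>
      then obtain t' where t: "t = Suc t'" by (cases t) (auto simp: level_order_0)
      have "?L \<noteq> []" using 2 k by auto
      then have ne: "level t \<noteq> []" by auto
      let ?z = "last (level t)"
      have "?ws ! k = last ?W" using 2
        by (cases "?W = []") (auto simp: nth_append last_conv_nth simp flip: 2)
      also have "\<dots> = ?z" using ne by (simp add: t level_order_Suc)
      finally have k_eq: "?ws ! k = ?z" .
      \<comment> \<open>\<open>?z\<close> lies above level \<open>d\<close>, so its block is
        nonempty; it stands first in the new level, and its first entry follows
        \<open>?z\<close>.\<close>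
      have "odd (length (child_list ?z))"
        using odd_length_child_list[OF last_in_set[OF ne]] Suc.prems by (simp add: t)
      then have "child_list ?z \<noteq> []" by auto
      moreover have "rev (level t) = ?z # rev (butlast (level t))"
        using arg_cong[OF append_butlast_last_id[OF ne], of rev]
        by (simp del: append_butlast_last_id)
      then have "?L = child_list ?z @ concat (map child_list (rev (butlast (level t))))"
        unfolding level.simps by (simp only: list.map concat.simps)
      ultimately have "?ws ! Suc k \<in> set (child_list ?z)"
        using 2 by (simp add: nth_append)
      then show ?thesis using block k_eq by simp
    next
      case 3
      define i where "i = k - length ?W"
      have k_eq: "k = length ?W + i" using 3 by (simp add: i_def)
      have i: "Suc i < length ?L" using k by (simp add: k_eq)
      have nth: "?ws ! k = ?L ! i" "?ws ! Suc k = ?L ! Suc i"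
        by (simp_all add: k_eq nth_append)
      have mem: "?L ! i \<in> set ?L" "?L ! Suc i \<in> set ?L"
        using nth_mem[OF i] nth_mem[OF Suc_lessD[OF i]] by blast+
      have depth_eq: "depth (?ws ! k) = depth (?ws ! Suc k)"
        using L(2)[OF mem(1)] L(2)[OF mem(2)] unfolding nth by metis
      show ?thesis
      proof (cases t)
        case 0
        \<comment> \<open>All vertices of level 1 are children of the root.\<close>
        then have "parent (?ws ! k) = c" "parent (?ws ! Suc k) = c"
          unfolding nth using L(1)[OF mem(1)] L(1)[OF mem(2)] by simp_all
        then show ?thesis using depth_eq by metis
      next
        case t: (Suc t')
        let ?n = "length (level t)"
        let ?B = "map child_list (rev (level t))"
        have "odd (length xs)" if "xs \<in> set ?B" for xs
          using that odd_length_child_list[of _ t] Suc.prems t by auto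
        from concat_odd_blocks_cases[of ?B i, OF this] i
        consider (one) m where "m < ?n" "?L ! i \<in> set (?B ! m)" "?L ! Suc i \<in> set (?B ! m)"
          | (two) m where "Suc m < ?n" "?L ! i \<in> set (?B ! m)" "?L ! Suc i \<in> set (?B ! Suc m)"
            "even (i + m)"
          by auto
        then show ?thesis
        proof cases
          case one
          then have "parent (?L ! i) = rev (level t) ! m" "parent (?L ! Suc i) = rev (level t) ! m"
            using block by simp_all
          then show ?thesis using depth_eq nth by metis
        next
          case two
          \<comment> \<open>Blocks \<open>m\<close> and \<open>m + 1\<close> belong to the vertices
            at places \<open>j + 1\<close> and \<open>j\<close> of level \<open>t\<close>, by
            reversal; \<open>j'\<close> below adds the length of the preceding levels.\<close>
          define j where "j = ?n - Suc (Suc m)"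
          have n: "?n = Suc (Suc (m + j))" using two(1) by (simp add: j_def)
          have "parent (?L ! i) = rev (level t) ! m"
            "parent (?L ! Suc i) = rev (level t) ! Suc m"
            using block two by simp_all
          then have par: "parent (?L ! i) = level t ! Suc j" "parent (?L ! Suc i) = level t ! j"
            using n by (simp_all add: rev_nth)
          define j' where "j' = length (level_order t') + j"
          have ws: "?W = level_order t' @ level t" by (simp add: t level_order_Suc)
          have "?ws ! j' = level t ! j" "?ws ! Suc j' = level t ! Suc j" "Suc j' < length ?ws"
            using n by (simp_all add: ws j'_def nth_append)
          moreover have "even (j' + k)"
          \<comment> \<open>The offsets of both levels are even and \<open>i\<close> has the parity
            of \<open>m\<close>. As level \<open>t\<close> has \<open>m + j + 2\<close> entries, an
            even number, \<open>j\<close> has it too.\<close>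
          proof -
            have "even (length (level_order t'))" "even (length ?W)"
              using even_length_level_order Suc.prems t by simp_all
            moreover have "even (m + j)"
              using even_length_level[of t'] Suc.prems n by (simp add: t del: level.simps)
            ultimately show ?thesis using two(4) unfolding j'_def k_eq by presburger
          qed
          ultimately show ?thesis using depth_eq par nth by metis
        qed
      qed
    qed
  qed
qed

lemma friendly: "friendly_to_simple_path V E"
proof (rule boustrophedon_imp_friendly)
  show "boustrophedon (level_order d)" by (simp add: boustrophedon_level_order)
  \<comment> \<open>No vertex is deeper than \<open>d\<close>, so the levels up to \<open>d\<close>
    exhaust the tree.\<close>
  show "set (level_order d) = V - {c}" using depth_le_and_pos by (auto simp: set_level_order)
  show "distinct (level_order d)" by (rule distinct_level_order)
qed

end

theorem mainTheorem2:
  fixes V :: "'a set" and E :: "'a set set"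
  assumes "fin_tree V E"
    and "\<exists>c\<in>V. \<exists>d. \<forall>l. leaf V E l \<longrightarrow> graph_dist V E c l = d"
    and "\<forall>v\<in>V. \<not> leaf V E v \<longrightarrow> even (vertex_degree E v)"
  shows "friendly_to_simple_path V E"
proof -
  from assms(2) obtain c d where c: "c \<in> V" and d: "\<forall>l. leaf V E l \<longrightarrow> graph_dist V E c l = d"
    by blast
  show ?thesis
  proof (cases "V = {c}")
    case True
    \<comment> \<open>An edge would need two distinct vertices; without edges the condition on the
      numbering is vacuous.\<close>
    then have "E = {}" using assms(1) by (fastforce simp: fin_tree_def fin_graph_def)
    then show ?thesis by (simp add: friendly_to_simple_path_def bij_betw_def)
  next
    case False
    interpret equidistant_leaves_tree V E c d
      using assms(1,3) c d False by unfold_locales auto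
    show ?thesis by (rule friendly)
  qed
qed

end
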